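(* Let $\mathcal{P}$ be a class of distributions on $\mathcal{X}$, $\theta:\mathcal{P}\to\Theta$ a functional, $\rho$ a semi-metric on $\Theta$, and $\Phi:\mathbb{R}_+\to\mathbb{R}_+$ a non-decreasing function with $\Phi(0)=0$. For $\varepsilon\in[0,1)$ let $$\omega(\varepsilon)=\sup\Big\{\rho(\theta(R_0),\theta(R_1)):\ \mathrm{TV}(R_0,R_1)\le \frac{\varepsilon}{1-\varepsilon},\ R_0,R_1\in\mathcal{P}\Big\}$$ be the total variation modulus of continuity. Write $\mathcal{R}_{n,\alpha}(\theta(\mathcal{P}),\Phi\circ\rho,\varepsilon)$ for the $\alpha$-LDP minimax risk under Huber $\varepsilon$-contamination and $\mathcal{R}_{n,\alpha}(\theta(\mathcal{P}),\Phi\circ\rho)=\mathcal{R}_{n,\alpha}(\theta(\mathcal{P}),\Phi\circ\rho,0)$ for the $\alpha$-LDP minimax risk without contamination. Then for any $\varepsilon\in[0,1)$ and any given $\alpha\in(0,\infty)$, $$\mathcal{R}_{n,\alpha}(\theta(\mathcal{P}),\Phi\circ\rho,\varepsilon)\ \ge\ \mathcal{R}_{n,\alpha}(\theta(\mathcal{P}),\Phi\circ\rho)\ \vee\ \frac{\Phi(\omega(\varepsilon)/2)}{2}.$$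
   Context: $a\vee b=\max(a,b)$. $\mathrm{TV}(P_a,P_b)=\sup_S|P_a(S)-P_b(S)|$ over measurable sets $S$. Huber contamination: let $\mathcal{G}\supset\mathcal{P}$ be the set of all distributions on $\mathcal{X}$. For fixed $\varepsilon$, $\mathcal{P}_\varepsilon(\mathcal{P})=\{P_\varepsilon=(1-\varepsilon)P+\varepsilon G:\ P\in\mathcal{P},\,G\in\mathcal{G}\}$. The raw data $X_1,\dots,X_n$ are i.i.d. from $P_\varepsilon$. Local differential privacy: an $\alpha$-LDP privacy mechanism $Q$ (possibly sequentially interactive) outputs $Z_1,\dots,Z_n\in\mathcal{Z}$, where $Z_i$ is drawn from a conditional distribution $Q_i(\cdot\,|\,x,z_1,\dots,z_{i-1})$ given $X_i=x$ and $Z_j=z_j$ for $j<i$ ($Z_1$ depends only on $X_1$), such that $$\max_{i}\ \sup_{A}\ \sup_{z_1,\dots,z_{i-1}\in\mathcal{Z}}\ \sup_{x,x'\in\mathcal{X}}\frac{Q_i(A|x,z_1,\dots,z_{i-1})}{Q_i(A|x',z_1,\dots,z_{i-1})}\le e^\alpha,$$ with $A$ ranging over measurable sets. $\mathcal{Q}_\alpha$ is the set of all $\alpha$-LDP privacy mechanisms. Minimax risk: $$\mathcal{R}_{n,\alpha}(\theta(\mathcal{P}),\Phi\circ\rho,\varepsilon)=\inf_{Q\in\mathcal{Q}_\alpha}\inf_{\hat\theta}\sup_{P_\varepsilon\in\mathcal{P}_\varepsilon(\mathcal{P})}\mathbb{E}_{P_\varepsilon,Q}\big[\Phi\{\rho(\hat\theta,\theta(P))\}\big],$$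 where $\hat\theta=\hat\theta(Z_1,\dots,Z_n)$ ranges over all measurable functions of the privatised data, the supremum is over all $P_\varepsilon=(1-\varepsilon)P+\varepsilon G$ with $P\in\mathcal{P}$, $G\in\mathcal{G}$ (the target being $\theta(P)$ for the inlier distribution $P$), and the expectation is over both the data and the privacy mechanism.
   Formalization: Added assumption, as the claim fails without it: ω(ε) is 0 or infinite, or the supremum defining ω(ε) is attained, or Φ is left-continuous at ω(ε)/2. The semi-metric ρ satisfies the triangle inequality, ρ(·,t) is measurable, and Φ(∞) means sup Φ. *)

theory Defs
  imports "HOL-Probability.Probability"
begin

text \<open>
  A measurable space is represented by a measure of which only \<open>space\<close> and \<open>sets\<close> matter.
  The distributions on \<open>X\<close> are the elements of \<open>space (prob_algebra X)\<close>.
\<close>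

definition tv_dist :: "'x measure \<Rightarrow> 'x measure \<Rightarrow> real" where
  "tv_dist P R = (SUP S\<in>sets P. \<bar>measure P S - measure R S\<bar>)"

definition contaminate :: "real \<Rightarrow> 'x measure \<Rightarrow> 'x measure \<Rightarrow> 'x measure" where
  "contaminate \<epsilon> P G = measure_of (space P) (sets P)
     (\<lambda>A. ennreal (1 - \<epsilon>) * emeasure P A + ennreal \<epsilon> * emeasure G A)"

lemma space_contaminate [simp]: "space (contaminate \<epsilon> P G) = space P"
  by (simp add: contaminate_def)

lemma sets_contaminate [simp, measurable_cong]: "sets (contaminate \<epsilon> P G) = sets P"
  by (simp add: contaminate_def)

lemma emeasure_contaminate:
  assumes "sets G = sets P" and "A \<in> sets P"
  shows "emeasure (contaminate \<epsilon> P G) A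
    = ennreal (1 - \<epsilon>) * emeasure P A + ennreal \<epsilon> * emeasure G A"
  unfolding contaminate_def
proof (rule emeasure_measure_of_sigma)
  show "sigma_algebra (space P) (sets P)"
    by (rule sets.sigma_algebra_axioms)
  show "positive (sets P) (\<lambda>A. ennreal (1 - \<epsilon>) * emeasure P A + ennreal \<epsilon> * emeasure G A)"
    by (simp add: positive_def)
  show "countably_additive (sets P)
      (\<lambda>A. ennreal (1 - \<epsilon>) * emeasure P A + ennreal \<epsilon> * emeasure G A)"
    using assms(1)
    by (auto simp: countably_additive_def suminf_add[symmetric] ennreal_suminf_cmult
        suminf_emeasure)
qed fact

lemma contaminate_in_prob_algebra:
  assumes "P \<in> space (prob_algebra X)" and "G \<in> space (prob_algebra X)"
    and "0 \<le> \<epsilon>" and "\<epsilon> \<le> 1"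
  shows "contaminate \<epsilon> P G \<in> space (prob_algebra X)"
proof -
  have P: "sets P = sets X" "prob_space P" and G: "sets G = sets X" "prob_space G"
    using assms by (auto simp: space_prob_algebra)
  have "emeasure G (space P) = 1"
    using P(1) G prob_space.emeasure_space_1 sets_eq_imp_space_eq by metis
  then have "emeasure (contaminate \<epsilon> P G) (space P) = 1"
    using P G assms(3,4) ennreal_plus[of "1 - \<epsilon>" \<epsilon>]
    by (subst emeasure_contaminate) (auto simp: prob_space.emeasure_space_1)
  then show ?thesis
    using P(1) by (auto simp: space_prob_algebra intro: prob_spaceI)
qed

text \<open>
  \<open>Q i (x, z)\<close> is the law of the \<open>i\<close>-th output (counting from 0) given the raw observation \<open>x\<close> and
  the earlier outputs \<open>z \<in> Z ^ {..<i}\<close>.  The likelihood ratio bound is stated without division, so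
  that a ratio \<open>c / 0\<close> with \<open>c > 0\<close> violates it and \<open>0 / 0\<close> does not.
\<close>

definition ldp_mechanisms ::
    "real \<Rightarrow> nat \<Rightarrow> 'x measure \<Rightarrow> 'z measure
      \<Rightarrow> (nat \<Rightarrow> 'x \<times> (nat \<Rightarrow> 'z) \<Rightarrow> 'z measure) set" where
  "ldp_mechanisms \<alpha> n X Z = {Q. \<forall>i<n.
     Q i \<in> X \<Otimes>\<^sub>M PiM {..<i} (\<lambda>_. Z) \<rightarrow>\<^sub>M prob_algebra Z \<and>
     (\<forall>A\<in>sets Z. \<forall>z\<in>space (PiM {..<i} (\<lambda>_. Z)). \<forall>x\<in>space X. \<forall>x'\<in>space X.
        measure (Q i (x, z)) A \<le> exp \<alpha> * measure (Q i (x', z)) A)}"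

text \<open>The joint law of the first \<open>i\<close> outputs when the raw data are \<open>x 0, x 1, \<dots>\<close>\<close>

primrec output_law ::
    "'z measure \<Rightarrow> (nat \<Rightarrow> 'x \<times> (nat \<Rightarrow> 'z) \<Rightarrow> 'z measure) \<Rightarrow> (nat \<Rightarrow> 'x) \<Rightarrow> nat
      \<Rightarrow> (nat \<Rightarrow> 'z) measure" where
  "output_law Z Q x 0 = return (PiM {..<0} (\<lambda>_. Z)) (\<lambda>_. undefined)"
| "output_law Z Q x (Suc i) = output_law Z Q x i \<bind>
     (\<lambda>z. distr (Q i (x i, z)) (PiM {..<Suc i} (\<lambda>_. Z)) (\<lambda>w. z(i := w)))"

lemma output_law_measurable:
  assumes Q: "Q \<in> ldp_mechanisms \<alpha> n X Z" and "i \<le> n"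
  shows "(\<lambda>x. output_law Z Q x i)
    \<in> PiM {..<n} (\<lambda>_. X) \<rightarrow>\<^sub>M prob_algebra (PiM {..<i} (\<lambda>_. Z))"
  using assms(2)
proof (induction i)
  case 0
  show ?case
    by (simp add: space_PiM space_prob_algebra prob_space_return)
next
  case (Suc i)
  have Qi [measurable]: "Q i \<in> X \<Otimes>\<^sub>M PiM {..<i} (\<lambda>_. Z) \<rightarrow>\<^sub>M prob_algebra Z"
    using Q Suc.prems by (auto simp: ldp_mechanisms_def)
  have [measurable]: "(\<lambda>x. output_law Z Q x i)
      \<in> PiM {..<n} (\<lambda>_. X) \<rightarrow>\<^sub>M prob_algebra (PiM {..<i} (\<lambda>_. Z))"
    using Suc by simp
  have [measurable]: "(\<lambda>x. x i) \<in> PiM {..<n} (\<lambda>_. X) \<rightarrow>\<^sub>M X"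
    using Suc.prems by (intro measurable_component_singleton) auto
  have [measurable]: "(\<lambda>(p, w). (snd p)(i := w))
      \<in> (PiM {..<n} (\<lambda>_. X) \<Otimes>\<^sub>M PiM {..<i} (\<lambda>_. Z)) \<Otimes>\<^sub>M Z \<rightarrow>\<^sub>M PiM {..<Suc i} (\<lambda>_. Z)"
    unfolding lessThan_Suc split_beta'
    by (rule measurable_fun_upd[where J="{..<i}"]) auto
  have "(\<lambda>(x, z). distr (Q i (x i, z)) (PiM {..<Suc i} (\<lambda>_. Z)) (\<lambda>w. z(i := w)))
      \<in> PiM {..<n} (\<lambda>_. X) \<Otimes>\<^sub>M PiM {..<i} (\<lambda>_. Z)
        \<rightarrow>\<^sub>M prob_algebra (PiM {..<Suc i} (\<lambda>_. Z))"
    unfolding split_beta'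
    by (rule measurable_distr_prob_space2[where M=Z]) (use Suc.prems in measurable)
  then show ?case
    unfolding output_law.simps
    by (intro measurable_bind_prob_space2[where N="PiM {..<i} (\<lambda>_. Z)"]) measurable
qed

definition risk ::
    "nat \<Rightarrow> 'x measure \<Rightarrow> 'z measure \<Rightarrow> (nat \<Rightarrow> 'x \<times> (nat \<Rightarrow> 'z) \<Rightarrow> 'z measure)
      \<Rightarrow> ((nat \<Rightarrow> 'z) \<Rightarrow> 't) \<Rightarrow> ('t \<Rightarrow> 't \<Rightarrow> real) \<Rightarrow> (real \<Rightarrow> real) \<Rightarrow> 't \<Rightarrow> ennreal" where
  "risk n R Z Q est \<rho> \<Phi> t =
     (\<integral>\<^sup>+ x. \<integral>\<^sup>+ z. ennreal (\<Phi> (\<rho> (est z) t)) \<partial>output_law Z Q x n \<partial>PiM {..<n} (\<lambda>_. R))"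

definition minimax_risk ::
    "nat \<Rightarrow> real \<Rightarrow> 'x measure \<Rightarrow> 'z measure \<Rightarrow> 't measure \<Rightarrow> 'x measure set
      \<Rightarrow> ('x measure \<Rightarrow> 't) \<Rightarrow> ('t \<Rightarrow> 't \<Rightarrow> real) \<Rightarrow> (real \<Rightarrow> real) \<Rightarrow> real \<Rightarrow> ennreal" where
  "minimax_risk n \<alpha> X Z \<Theta> \<P> \<theta> \<rho> \<Phi> \<epsilon> =
     (INF Q\<in>ldp_mechanisms \<alpha> n X Z.
      INF est\<in>PiM {..<n} (\<lambda>_. Z) \<rightarrow>\<^sub>M \<Theta>.
      SUP P\<in>\<P>. SUP G\<in>space (prob_algebra X).
        risk n (contaminate \<epsilon> P G) Z Q est \<rho> \<Phi> (\<theta> P))"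

definition tv_modulus ::
    "'x measure set \<Rightarrow> ('x measure \<Rightarrow> 't) \<Rightarrow> ('t \<Rightarrow> 't \<Rightarrow> real) \<Rightarrow> real \<Rightarrow> ennreal" where
  "tv_modulus \<P> \<theta> \<rho> \<epsilon> =
     Sup {ennreal (\<rho> (\<theta> R0) (\<theta> R1)) | R0 R1.
       R0 \<in> \<P> \<and> R1 \<in> \<P> \<and> tv_dist R0 R1 \<le> \<epsilon> / (1 - \<epsilon>)}"

text \<open>The semi-metric satisfies the triangle inequality but may vanish between distinct points.\<close>

definition semimetric_on :: "'t set \<Rightarrow> ('t \<Rightarrow> 't \<Rightarrow> real) \<Rightarrow> bool" where
  "semimetric_on T \<rho> \<longleftrightarrow>
     (\<forall>s\<in>T. \<forall>t\<in>T. 0 \<le> \<rho> s t \<and> \<rho> s t = \<rho> t s) \<and>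
     (\<forall>t\<in>T. \<rho> t t = 0) \<and>
     (\<forall>s\<in>T. \<forall>t\<in>T. \<forall>u\<in>T. \<rho> s u \<le> \<rho> s t + \<rho> t u)"

text \<open>The modulus may be infinite; the loss is extended by \<open>\<Phi>(\<infinity>) = sup \<Phi>\<close>.\<close>

definition loss_ext :: "(real \<Rightarrow> real) \<Rightarrow> ennreal \<Rightarrow> ennreal" where
  "loss_ext \<Phi> u =
     (if u = \<top> then SUP s\<in>{0..}. ennreal (\<Phi> s) else ennreal (\<Phi> (enn2real u)))"

end

theory Submission
  imports Defs
begin

text \<open>
  The first bound holds because contaminating \<open>P\<close> with \<open>G = P\<close> changes nothing.  For the second, if
  \<open>TV(R\<^sub>0, R\<^sub>1) \<le> \<epsilon> / (1 - \<epsilon>)\<close>, the least common upper bound of \<open>(1 - \<epsilon>) R\<^sub>0\<close> and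
  \<open>(1 - \<epsilon>) R\<^sub>1\<close> has mass \<open>(1 - \<epsilon>) (1 + TV(R\<^sub>0, R\<^sub>1)) \<le> 1\<close>, so it can be completed to a
  distribution \<open>T\<close> that is a contamination of both.  The output of any mechanism fed with data from
  \<open>T\<close> does not reveal whether \<open>\<theta>(R\<^sub>0)\<close> or \<open>\<theta>(R\<^sub>1)\<close> is the target, and every estimate is at distance
  at least \<open>\<rho>(\<theta>(R\<^sub>0), \<theta>(R\<^sub>1)) / 2\<close> from one of them.
\<close>

section \<open>Contaminations of a single distribution\<close>

lemma contaminate_self:
  assumes "0 \<le> \<epsilon>" and "\<epsilon> \<le> 1"
  shows "contaminate \<epsilon> P P = P"
proof (rule measure_eqI)
  fix A assume "A \<in> sets (contaminate \<epsilon> P P)"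
  then have "emeasure (contaminate \<epsilon> P P) A = (ennreal (1 - \<epsilon>) + ennreal \<epsilon>) * emeasure P A"
    by (simp add: emeasure_contaminate distrib_right)
  also have "ennreal (1 - \<epsilon>) + ennreal \<epsilon> = 1"
    using assms by (simp flip: ennreal_plus)
  finally show "emeasure (contaminate \<epsilon> P P) A = emeasure P A"
    by simp
qed simp

lemma contaminate_0:
  assumes "sets G = sets P"
  shows "contaminate 0 P G = P"
  using assms by (intro measure_eqI) (auto simp: emeasure_contaminate)

text \<open>Equal total mass makes domination symmetric: applied to the complement of
  \<open>A\<close>, the hypothesis gives the reverse inequality for \<open>A\<close>.\<close>

lemma prob_measure_eqI_le:
  assumes "prob_space M" and "prob_space N" and sets: "sets M = sets N"
    and le: "\<And>A. A \<in> sets M \<Longrightarrow> measure M A \<le> measure N A"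
  shows "M = N"
proof (rule measure_eqI)
  interpret M: prob_space M by fact
  interpret N: prob_space N by fact
  fix A assume A: "A \<in> sets M"
  have "1 - measure M A \<le> 1 - measure N A"
    using le[of "space M - A"] A sets sets_eq_imp_space_eq[OF sets] M.prob_compl[of A]
      N.prob_compl[of A] by simp
  then show "emeasure M A = emeasure N A"
    using le[OF A] by (simp add: M.emeasure_eq_measure N.emeasure_eq_measure)
qed (fact sets)

text \<open>Solving \<open>contaminate \<epsilon> P G = T\<close> for \<open>G\<close> gives
  \<open>G = (T - (1 - \<epsilon>) P) / \<epsilon>\<close>; domination of
  \<open>(1 - \<epsilon>) P\<close> by \<open>T\<close> is what makes this a nonnegative measure.
  Being a contamination of \<open>P\<close> is thereby reduced to a setwise inequality.\<close>

lemma ex_contaminate_eq: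
  assumes P: "P \<in> space (prob_algebra X)" and T: "T \<in> space (prob_algebra X)"
    and "0 \<le> \<epsilon>" and "\<epsilon> \<le> 1"
    and le: "\<And>A. A \<in> sets X \<Longrightarrow> (1 - \<epsilon>) * measure P A \<le> measure T A"
  shows "\<exists>G\<in>space (prob_algebra X). contaminate \<epsilon> P G = T"
proof (cases "\<epsilon> = 0")
  case True
  \<comment> \<open>There is no quotient by \<open>\<epsilon>\<close> here; domination between
    probability measures already forces equality.\<close>
  have "P = T"
    using P T le True by (intro prob_measure_eqI_le) (auto simp: space_prob_algebra)
  then show ?thesis
    using T True contaminate_self[of 0 T] by auto
next
  case False
  then have eps: "0 < \<epsilon>" using assms by simp
  have setsP: "sets P = sets X" and setsT: "sets T = sets X"
    using P T by (auto simp: space_prob_algebra)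
  interpret P: prob_space P using P by (simp add: space_prob_algebra)
  interpret T: prob_space T using T by (simp add: space_prob_algebra)
  define N where "N = scale_measure (ennreal (1 - \<epsilon>)) P"
  define G where "G = scale_measure (ennreal (1 / \<epsilon>)) (diff_measure T N)"
  have N: "emeasure N A = ennreal ((1 - \<epsilon>) * measure P A)" for A
    using assms by (simp add: N_def P.emeasure_eq_measure ennreal_mult)
  have [simp]: "sets N = sets X"
    by (simp add: N_def setsP)
  have "finite_measure N"
    by standard (simp add: N)
  have G: "emeasure G A = ennreal ((measure T A - (1 - \<epsilon>) * measure P A) / \<epsilon>)" if "A \<in> sets X" for A
  proof -
    have "emeasure (diff_measure T N) A = emeasure T A - emeasure N A"
      using that setsT \<open>finite_measure N\<close> T.finite_measure_axioms le
      by (intro emeasure_diff_measure) (auto simp: N T.emeasure_eq_measure)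
    also have "\<dots> = ennreal (measure T A - (1 - \<epsilon>) * measure P A)"
      using assms by (simp add: N T.emeasure_eq_measure ennreal_minus)
    finally show ?thesis
      using eps le[OF that] by (simp add: G_def flip: ennreal_mult)
  qed
  have setsG [simp]: "sets G = sets X"
    by (simp add: G_def setsT)
  have "space G = space X" "space P = space X" "space T = space X"
    using sets_eq_imp_space_eq setsG setsP setsT by blast+
  \<comment> \<open>The mass is \<open>(1 - (1 - \<epsilon>)) / \<epsilon>\<close>.\<close>
  then have "emeasure G (space G) = 1"
    using P.prob_space T.prob_space eps by (simp add: G)
  then have "G \<in> space (prob_algebra X)"
    by (simp add: space_prob_algebra prob_spaceI)
  moreover have "contaminate \<epsilon> P G = T"
  proof (rule measure_eqI)
    fix A assume "A \<in> sets (contaminate \<epsilon> P G)"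
    then have A: "A \<in> sets X" by (simp add: setsP)
    show "emeasure (contaminate \<epsilon> P G) A = emeasure T A"
      using A eps le[OF A] assms(4)
      by (simp add: emeasure_contaminate setsP G P.emeasure_eq_measure T.emeasure_eq_measure
          flip: ennreal_mult ennreal_plus)
  qed (simp add: setsP setsT)
  ultimately show ?thesis by blast
qed

section \<open>A common contamination of two distributions close in total variation\<close>

lemma emeasure_sup_measure'_le_tv_dist:
  assumes "prob_space P" and "prob_space R" and sets: "sets R = sets P"
  shows "emeasure (sup_measure' P R) (space P) \<le> ennreal (1 + tv_dist P R)"
proof -
  interpret P: prob_space P by fact
  interpret R: prob_space R by fact
  have spaceR: "space R = space P"
    using sets by (rule sets_eq_imp_space_eq)
  \<comment> \<open>A supremum of reals dominates its terms only if the family is bounded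
    above.\<close>
  have bdd: "bdd_above ((\<lambda>S. \<bar>measure P S - measure R S\<bar>) ` sets P)"
  proof (rule bdd_aboveI2)
    show "\<bar>measure P S - measure R S\<bar> \<le> 1" for S
      using P.prob_le_1[of S] R.prob_le_1[of S] measure_nonneg[of P S] measure_nonneg[of R S]
      by linarith
  qed
  \<comment> \<open>The mass of \<open>sup_measure' P R\<close> is the supremum of these sums over
    \<open>Y\<close>. Each sum equals \<open>1 + P(Y) - R(Y)\<close>.\<close>
  have "emeasure P (space P \<inter> Y) + emeasure R (space P \<inter> - Y) \<le> ennreal (1 + tv_dist P R)"
    if Y: "Y \<in> sets P" for Y
  proof -
    have "measure R (space P \<inter> - Y) = 1 - measure R Y"
      using R.prob_compl[of Y] Y sets spaceR by (simp add: Diff_eq)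
    moreover have "measure P Y - measure R Y \<le> tv_dist P R"
      using cSUP_upper[OF Y bdd] by (simp add: tv_dist_def)
    moreover have "space P \<inter> Y = Y"
      using sets.sets_into_space[OF Y] by blast
    ultimately show ?thesis
      by (simp add: P.emeasure_eq_measure R.emeasure_eq_measure ennreal_leI flip: ennreal_plus)
  qed
  then show ?thesis
    by (subst emeasure_sup_measure') (auto simp: sets intro: SUP_least)
qed

text \<open>By \<open>ex_contaminate_eq\<close> it suffices to find one distribution above both
  \<open>(1 - \<epsilon>) R0\<close> and \<open>(1 - \<epsilon>) R1\<close>. The bound on
  \<open>tv_dist\<close> leaves just enough room, because
  \<open>1 + \<epsilon> / (1 - \<epsilon>) = 1 / (1 - \<epsilon>)\<close>.\<close>

lemma ex_common_contamination:
  assumes R0: "R0 \<in> space (prob_algebra X)" and R1: "R1 \<in> space (prob_algebra X)"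
    and eps: "0 \<le> \<epsilon>" "\<epsilon> < 1" and tv: "tv_dist R0 R1 \<le> \<epsilon> / (1 - \<epsilon>)"
  shows "\<exists>G0\<in>space (prob_algebra X). \<exists>G1\<in>space (prob_algebra X).
    contaminate \<epsilon> R0 G0 = contaminate \<epsilon> R1 G1"
proof -
  have sets0: "sets R0 = sets X" and sets1: "sets R1 = sets X"
    using R0 R1 by (auto simp: space_prob_algebra)
  have sets10 [simp]: "sets R1 = sets R0"
    by (simp add: sets0 sets1)
  interpret R0: prob_space R0 using R0 by (simp add: space_prob_algebra)
  interpret R1: prob_space R1 using R1 by (simp add: space_prob_algebra)
  define S where "S = sup_measure' R0 R1"
  have [simp]: "sets S = sets X" "space S = space R0"
    by (simp_all add: S_def sets0)
  have "1 + tv_dist R0 R1 \<le> 1 + \<epsilon> / (1 - \<epsilon>)"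
    using tv by simp
  also have "\<dots> = 1 / (1 - \<epsilon>)"
    using eps by (simp add: field_simps)
  finally have S_le: "emeasure S (space S) \<le> ennreal (1 / (1 - \<epsilon>))"
    using emeasure_sup_measure'_le_tv_dist[OF R0.prob_space_axioms R1.prob_space_axioms sets10]
    by (simp add: S_def) (meson ennreal_leI order_trans)
  interpret S: finite_measure S
    using S_le by (intro finite_measureI) (auto simp: top_unique)
  have le0: "measure R0 A \<le> measure S A" and le1: "measure R1 A \<le> measure S A" if "A \<in> sets X" for A
    using le_emeasure_sup_measure'1[of R1 R0 A] le_emeasure_sup_measure'2[of R1 R0 A] that
    by (simp_all add: sets0 R0.emeasure_eq_measure R1.emeasure_eq_measure S.emeasure_eq_measure
        flip: S_def)
  define m where "m = measure S (space S)"
  have "1 \<le> m"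
    using le0[of "space R0"] R0.prob_space sets.top[of R0] by (simp add: m_def sets0)
  have "m \<le> 1 / (1 - \<epsilon>)"
    using S_le eps by (simp add: m_def S.emeasure_eq_measure)
  then have m1: "(1 - \<epsilon>) * m \<le> 1"
    using eps by (simp add: field_simps)
  have m0: "0 \<le> (1 - \<epsilon>) * m"
    using eps \<open>1 \<le> m\<close> by simp
  \<comment> \<open>Here \<open>contaminate\<close> serves as a plain mixture: weight
    \<open>(1 - \<epsilon>) * m\<close> on the normalised \<open>S\<close>, the remaining weight on
    \<open>R0\<close>. Thus \<open>T\<close> is \<open>(1 - \<epsilon>) S\<close> plus a multiple of
    \<open>R0\<close> that fills the mass up to \<open>1\<close>; \<open>m1\<close> makes that
    multiple nonnegative.\<close>
  define T where
    "T = contaminate (1 - (1 - \<epsilon>) * m) (scale_measure (ennreal (1 / m)) S) R0"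
  have "emeasure (scale_measure (ennreal (1 / m)) S) (space S) = 1"
    using \<open>1 \<le> m\<close> by (simp add: S.emeasure_eq_measure flip: ennreal_mult m_def del: \<open>space S = _\<close>)
  then have "scale_measure (ennreal (1 / m)) S \<in> space (prob_algebra X)"
    by (simp add: space_prob_algebra prob_spaceI space_scale_measure)
  then have T: "T \<in> space (prob_algebra X)"
    unfolding T_def using R0 m0 m1 by (intro contaminate_in_prob_algebra) auto
  interpret T: prob_space T using T by (simp add: space_prob_algebra)
  have T_ge: "(1 - \<epsilon>) * measure S A \<le> measure T A" if A: "A \<in> sets X" for A
  proof -
    have "emeasure T A = ennreal ((1 - \<epsilon>) * m) * (ennreal (1 / m) * emeasure S A)
        + ennreal (1 - (1 - \<epsilon>) * m) * emeasure R0 A"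
      using A unfolding T_def by (subst emeasure_contaminate) (auto simp: sets0)
    also have "\<dots> \<ge> ennreal ((1 - \<epsilon>) * m) * (ennreal (1 / m) * emeasure S A)"
      by simp
    also have "ennreal ((1 - \<epsilon>) * m) * (ennreal (1 / m) * emeasure S A)
        = ennreal ((1 - \<epsilon>) * measure S A)"
      using m0 eps \<open>1 \<le> m\<close> by (simp add: S.emeasure_eq_measure flip: ennreal_mult)
    finally show ?thesis
      by (simp add: T.emeasure_eq_measure)
  qed
  have "(1 - \<epsilon>) * measure R0 A \<le> measure T A" "(1 - \<epsilon>) * measure R1 A \<le> measure T A"
    if "A \<in> sets X" for A
    using T_ge[OF that] le0[OF that] le1[OF that] eps
    by (meson diff_ge_0_iff_ge less_imp_le mult_left_mono order_trans)+
  then show ?thesis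
    using ex_contaminate_eq[OF R0 T] ex_contaminate_eq[OF R1 T] eps by (metis less_imp_le)
qed

section \<open>Two targets under one law of the data\<close>

lemma risk_two_point:
  assumes R: "R \<in> space (prob_algebra X)" and Q: "Q \<in> ldp_mechanisms \<alpha> n X Z"
    and est: "est \<in> PiM {..<n} (\<lambda>_. Z) \<rightarrow>\<^sub>M \<Theta>"
    and \<rho>: "semimetric_on (space \<Theta>) \<rho>"
    and \<rho>_meas: "\<And>t. t \<in> space \<Theta> \<Longrightarrow> (\<lambda>s. \<rho> s t) \<in> borel_measurable \<Theta>"
    and mono: "mono_on {0..} \<Phi>" and "\<Phi> 0 = 0"
    and t: "t0 \<in> space \<Theta>" "t1 \<in> space \<Theta>"
  shows "ennreal (\<Phi> (\<rho> t0 t1 / 2)) \<le> risk n R Z Q est \<rho> \<Phi> t0 + risk n R Z Q est \<rho> \<Phi> t1"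
proof -
  let ?Zn = "PiM {..<n} (\<lambda>_. Z)" and ?Xn = "PiM {..<n} (\<lambda>_. X)" and ?Rn = "PiM {..<n} (\<lambda>_. R)"
  let ?K = "\<lambda>x. output_law Z Q x n"
  let ?L = "\<lambda>t z. ennreal (\<Phi> (\<rho> (est z) t))"
  have est_space: "est z \<in> space \<Theta>" if "z \<in> space ?Zn" for z
    using measurable_space[OF est that] .
  have L [measurable]: "?L t \<in> borel_measurable ?Zn" if t: "t \<in> space \<Theta>" for t
  proof -
    have "(\<lambda>z. \<rho> (est z) t) \<in> borel_measurable ?Zn"
      using measurable_compose[OF est \<rho>_meas[OF t]] .
    \<comment> \<open>Monotonicity, and hence measurability, of \<open>\<Phi>\<close> is known only
      on the nonnegative reals, so the composition passes through the restricted Borel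
      space.\<close>
    then have "(\<lambda>z. \<rho> (est z) t) \<in> ?Zn \<rightarrow>\<^sub>M restrict_space borel {0..}"
      using \<rho> est_space t by (intro measurable_restrict_space2) (auto simp: semimetric_on_def)
    from measurable_compose[OF this borel_measurable_mono_on_fnc[OF mono]] show ?thesis
      by simp
  qed
  have "sets ?Rn = sets ?Xn"
    using R by (intro sets_PiM_cong) (auto simp: space_prob_algebra)
  then have K [measurable]: "?K \<in> ?Rn \<rightarrow>\<^sub>M prob_algebra ?Zn"
    using output_law_measurable[OF Q order_refl] measurable_cong_sets by blast
  have inner [measurable]: "(\<lambda>x. \<integral>\<^sup>+ z. ?L t z \<partial>?K x) \<in> borel_measurable ?Rn"
    if [measurable]: "t \<in> space \<Theta>" for t
    using L[OF that] measurable_prob_algebraD[OF K]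
    by (intro nn_integral_measurable_subprob_algebra2[where N="?Zn"]) measurable
  have Phi_nonneg: "0 \<le> \<Phi> u" if "0 \<le> u" for u
    using mono_onD[OF mono, of 0 u] that \<open>\<Phi> 0 = 0\<close> by simp
  \<comment> \<open>By the triangle inequality through \<open>est z\<close>, the two distances
    cannot both be less than half of \<open>\<rho> t0 t1\<close>; the larger loss is then bounded by
    monotonicity and the other one is nonnegative.\<close>
  have pointwise: "ennreal (\<Phi> (\<rho> t0 t1 / 2)) \<le> ?L t0 z + ?L t1 z" if z: "z \<in> space ?Zn" for z
  proof -
    have "0 \<le> \<rho> t0 t1" "0 \<le> \<rho> (est z) t0" "0 \<le> \<rho> (est z) t1"
      and tri: "\<rho> t0 t1 \<le> \<rho> (est z) t0 + \<rho> (est z) t1"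
      using \<rho> est_space[OF z] t unfolding semimetric_on_def by metis+
    then consider "\<rho> t0 t1 / 2 \<le> \<rho> (est z) t0" | "\<rho> t0 t1 / 2 \<le> \<rho> (est z) t1"
      by linarith
    then have "\<Phi> (\<rho> t0 t1 / 2) \<le> \<Phi> (\<rho> (est z) t0) + \<Phi> (\<rho> (est z) t1)"
    proof cases
      case 1
      then have "\<Phi> (\<rho> t0 t1 / 2) \<le> \<Phi> (\<rho> (est z) t0)"
        using \<open>0 \<le> \<rho> t0 t1\<close> \<open>0 \<le> \<rho> (est z) t0\<close> by (intro mono_onD[OF mono]) auto
      then show ?thesis
        using Phi_nonneg[OF \<open>0 \<le> \<rho> (est z) t1\<close>] by linarith
    next
      case 2
      then have "\<Phi> (\<rho> t0 t1 / 2) \<le> \<Phi> (\<rho> (est z) t1)"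
        using \<open>0 \<le> \<rho> t0 t1\<close> \<open>0 \<le> \<rho> (est z) t1\<close> by (intro mono_onD[OF mono]) auto
      then show ?thesis
        using Phi_nonneg[OF \<open>0 \<le> \<rho> (est z) t0\<close>] by linarith
    qed
    then show ?thesis
      using Phi_nonneg \<open>0 \<le> \<rho> (est z) t0\<close> \<open>0 \<le> \<rho> (est z) t1\<close>
      by (simp add: ennreal_leI flip: ennreal_plus)
  qed
  have lower: "ennreal (\<Phi> (\<rho> t0 t1 / 2)) \<le> (\<integral>\<^sup>+ z. ?L t0 z \<partial>?K x) + (\<integral>\<^sup>+ z. ?L t1 z \<partial>?K x)"
    if x: "x \<in> space ?Rn" for x
  proof -
    have "?K x \<in> space (prob_algebra ?Zn)"
      using measurable_space[OF K x] .
    then interpret K: prob_space "?K x"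
      by (simp add: space_prob_algebra)
    have sK: "sets (?K x) = sets ?Zn"
      using \<open>?K x \<in> _\<close> by (simp add: space_prob_algebra)
    have "ennreal (\<Phi> (\<rho> t0 t1 / 2)) = (\<integral>\<^sup>+ z. ennreal (\<Phi> (\<rho> t0 t1 / 2)) \<partial>?K x)"
      by (simp add: K.emeasure_space_1)
    also have "\<dots> \<le> (\<integral>\<^sup>+ z. ?L t0 z + ?L t1 z \<partial>?K x)"
      using sets_eq_imp_space_eq[OF sK] by (intro nn_integral_mono pointwise) simp
    also have "\<dots> = (\<integral>\<^sup>+ z. ?L t0 z \<partial>?K x) + (\<integral>\<^sup>+ z. ?L t1 z \<partial>?K x)"
      using L t sK by (intro nn_integral_add) (auto cong: measurable_cong_sets)
    finally show ?thesis .
  qed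
  interpret Rn: prob_space ?Rn
    using R by (intro prob_space_PiM) (simp add: space_prob_algebra)
  \<comment> \<open>Both risks integrate over the same \<open>R\<close> and the same kernel, so the
    pointwise bound survives averaging, first over the outputs and now over the data.\<close>
  have "ennreal (\<Phi> (\<rho> t0 t1 / 2)) = (\<integral>\<^sup>+ x. ennreal (\<Phi> (\<rho> t0 t1 / 2)) \<partial>?Rn)"
    by (simp add: Rn.emeasure_space_1)
  also have "\<dots> \<le> (\<integral>\<^sup>+ x. (\<integral>\<^sup>+ z. ?L t0 z \<partial>?K x) + (\<integral>\<^sup>+ z. ?L t1 z \<partial>?K x) \<partial>?Rn)"
    by (intro nn_integral_mono lower)
  also have "\<dots> = risk n R Z Q est \<rho> \<Phi> t0 + risk n R Z Q est \<rho> \<Phi> t1"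
    unfolding risk_def using inner t by (intro nn_integral_add) auto
  finally show ?thesis .
qed

section \<open>Lower bounds for the minimax risk\<close>

lemma minimax_risk_mono_contamination:
  assumes \<P>: "\<P> \<subseteq> space (prob_algebra X)" and eps: "0 \<le> \<epsilon>" "\<epsilon> \<le> 1"
  shows "minimax_risk n \<alpha> X Z \<Theta> \<P> \<theta> \<rho> \<Phi> 0 \<le> minimax_risk n \<alpha> X Z \<Theta> \<P> \<theta> \<rho> \<Phi> \<epsilon>"
  unfolding minimax_risk_def
proof (intro INF_mono' SUP_least)
  fix Q est P G
  assume P: "P \<in> \<P>" and G: "G \<in> space (prob_algebra X)"
  have P': "P \<in> space (prob_algebra X)"
    using P \<P> by blast
  have "contaminate 0 P G = contaminate \<epsilon> P P"
    using P' G eps by (simp add: contaminate_0 contaminate_self space_prob_algebra)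
  then show "risk n (contaminate 0 P G) Z Q est \<rho> \<Phi> (\<theta> P)
      \<le> (SUP P\<in>\<P>. SUP G\<in>space (prob_algebra X). risk n (contaminate \<epsilon> P G) Z Q est \<rho> \<Phi> (\<theta> P))"
    using P P' by (intro SUP_upper2[OF P] SUP_upper2[OF P']) simp
qed

text \<open>For a fixed mechanism and estimator, the risks for \<open>R0\<close> and
  \<open>R1\<close> under their common contamination are two terms of the same supremum. Their sum
  is at most twice that supremum, which is the source of the factor one half.\<close>

lemma minimax_risk_ge_two_point:
  assumes \<P>: "\<P> \<subseteq> space (prob_algebra X)" and \<theta>: "\<theta> \<in> \<P> \<rightarrow> space \<Theta>"
    and \<rho>: "semimetric_on (space \<Theta>) \<rho>"
    and \<rho>_meas: "\<And>t. t \<in> space \<Theta> \<Longrightarrow> (\<lambda>s. \<rho> s t) \<in> borel_measurable \<Theta>"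
    and mono: "mono_on {0..} \<Phi>" and "\<Phi> 0 = 0"
    and eps: "0 \<le> \<epsilon>" "\<epsilon> < 1"
    and R: "R0 \<in> \<P>" "R1 \<in> \<P>" and tv: "tv_dist R0 R1 \<le> \<epsilon> / (1 - \<epsilon>)"
  shows "ennreal (\<Phi> (\<rho> (\<theta> R0) (\<theta> R1) / 2)) / 2 \<le> minimax_risk n \<alpha> X Z \<Theta> \<P> \<theta> \<rho> \<Phi> \<epsilon>"
  unfolding minimax_risk_def
proof (intro INF_greatest)
  fix Q est
  assume Q: "Q \<in> ldp_mechanisms \<alpha> n X Z" and est: "est \<in> PiM {..<n} (\<lambda>_. Z) \<rightarrow>\<^sub>M \<Theta>"
  let ?S = "SUP P\<in>\<P>. SUP G\<in>space (prob_algebra X). risk n (contaminate \<epsilon> P G) Z Q est \<rho> \<Phi> (\<theta> P)"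
  obtain G0 G1 where G: "G0 \<in> space (prob_algebra X)" "G1 \<in> space (prob_algebra X)"
    and eq: "contaminate \<epsilon> R0 G0 = contaminate \<epsilon> R1 G1"
    using ex_common_contamination[OF _ _ eps tv] R \<P> by blast
  have T: "contaminate \<epsilon> R0 G0 \<in> space (prob_algebra X)"
    using R \<P> G eps by (intro contaminate_in_prob_algebra) auto
  have "ennreal (\<Phi> (\<rho> (\<theta> R0) (\<theta> R1) / 2))
      \<le> risk n (contaminate \<epsilon> R0 G0) Z Q est \<rho> \<Phi> (\<theta> R0)
        + risk n (contaminate \<epsilon> R1 G1) Z Q est \<rho> \<Phi> (\<theta> R1)"
    \<comment> \<open>Both risks now refer to the same data law, as \<open>risk_two_point\<close>
      requires.\<close>
    unfolding eq[symmetric]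
    using R \<theta> by (intro risk_two_point[OF T Q est \<rho> \<rho>_meas mono \<open>\<Phi> 0 = 0\<close>]) auto
  also have "\<dots> \<le> ?S + ?S"
    by (intro add_mono SUP_upper2[OF R(1)] SUP_upper2[OF R(2)] SUP_upper G)
  also have "\<dots> = ?S * 2"
    by (simp add: mult_2_right)
  finally show "ennreal (\<Phi> (\<rho> (\<theta> R0) (\<theta> R1) / 2)) / 2 \<le> ?S"
    by (simp add: divide_le_posI_ennreal mult.commute)
qed

text \<open>If the supremum \<open>w\<close> is not attained, the bounds on \<open>D\<close> reach
  only \<open>\<Phi> s\<close> with \<open>s\<close> below \<open>w / 2\<close>, and a jump of
  \<open>\<Phi>\<close> at \<open>w / 2\<close> could exceed them all. Attainment or left-continuity
  excludes this; at \<open>0\<close> and \<open>\<top>\<close> the value of \<open>loss_ext\<close>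
  itself does.\<close>

lemma loss_ext_le:
  assumes mono: "mono_on {0..} \<Phi>" and "\<Phi> 0 = 0"
    and le: "\<And>r. r \<in> D \<Longrightarrow> ennreal (\<Phi> (r / 2)) \<le> c"
    and nonneg: "\<And>r. r \<in> D \<Longrightarrow> 0 \<le> r"
    and w: "w = (SUP r\<in>D. ennreal r)"
    and regular: "w \<in> {0, \<top>} \<or> w \<in> ennreal ` D \<or> continuous (at_left (enn2real (w / 2))) \<Phi>"
  shows "loss_ext \<Phi> (w / 2) \<le> c"
proof -
  have half: "ennreal r / 2 = ennreal (r / 2)" if "0 \<le> r" for r
    using that by (simp add: divide_ennreal flip: ennreal_numeral)
  have attained: "loss_ext \<Phi> (w / 2) \<le> c" if "r \<in> D" "w = ennreal r" for r
    using that le[of r] nonneg[of r] by (simp add: loss_ext_def half)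
  have below: "ennreal (\<Phi> s) \<le> c" if s: "0 \<le> s" "ennreal (2 * s) < w" for s
  proof -
    obtain r where r: "r \<in> D" "ennreal (2 * s) < ennreal r"
      using s(2) unfolding w by (auto simp: less_SUP_iff)
    then have "s \<le> r / 2"
      using s by (simp add: ennreal_less_iff)
    then have "\<Phi> s \<le> \<Phi> (r / 2)"
      using s by (intro mono_onD[OF mono]) auto
    then show ?thesis
      using le[OF r(1)] ennreal_leI order_trans by blast
  qed
  from regular consider "w = 0" | "w = \<top>" | r where "r \<in> D" "w = ennreal r"
    | "w \<noteq> 0" "w \<noteq> \<top>" "continuous (at_left (enn2real (w / 2))) \<Phi>"
    by auto
  then show ?thesis
  proof cases
    \<comment> \<open>This covers an empty \<open>D\<close> too, whose supremum in
      \<open>ennreal\<close> is \<open>0\<close>.\<close>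
    case 1
    then show ?thesis
      by (simp add: loss_ext_def \<open>\<Phi> 0 = 0\<close>)
  next
    case 2
    then have "w / 2 = \<top>"
      by (simp add: ennreal_top_divide)
    \<comment> \<open>Every real \<open>2 * s\<close> lies below \<open>w\<close>, so
      \<open>below\<close> bounds each term of the supremum defining \<open>loss_ext\<close> at
      \<open>\<top>\<close>.\<close>
    then show ?thesis
      using 2 by (auto simp: loss_ext_def intro!: SUP_least below)
  next
    case 3
    then show ?thesis
      by (rule attained)
  next
    case 4
    define L where "L = enn2real w / 2"
    have wL: "w = ennreal (2 * L)"
      using 4 by (simp add: L_def less_top)
    have "0 < L"
      using 4 by (simp add: L_def enn2real_positive_iff less_top zero_less_iff_neq_zero)
    have w2: "w / 2 = ennreal L"
      unfolding wL using \<open>0 < L\<close> by (simp add: half)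
    have "(\<Phi> \<longlongrightarrow> \<Phi> L) (at_left L)"
      using 4 \<open>0 < L\<close> by (simp add: w2 continuous_within)
    then have "((\<lambda>s. ennreal (\<Phi> s)) \<longlongrightarrow> ennreal (\<Phi> L)) (at_left L)"
      by (rule tendsto_ennrealI)
    \<comment> \<open>Every \<open>s\<close> strictly between \<open>0\<close> and \<open>L\<close>
      satisfies \<open>2 * s < w\<close>; the bound then passes to the left limit
      \<open>\<Phi> L\<close>.\<close>
    moreover have "\<forall>\<^sub>F s in at_left L. ennreal (\<Phi> s) \<le> c"
      using eventually_at_left_real[OF \<open>0 < L\<close>]
      by eventually_elim (auto simp: wL ennreal_less_iff intro!: below)
    ultimately have "ennreal (\<Phi> L) \<le> c"
      by (rule tendsto_upperbound) simp
    then show ?thesis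
      using \<open>0 < L\<close> by (simp add: loss_ext_def w2)
  qed
qed

theorem proposition1:
  fixes X :: "'x measure" and Z :: "'z measure" and \<Theta> :: "'t measure"
    and \<P> :: "'x measure set" and \<theta> :: "'x measure \<Rightarrow> 't"
    and \<rho> :: "'t \<Rightarrow> 't \<Rightarrow> real" and \<Phi> :: "real \<Rightarrow> real"
    and n :: nat and \<alpha> \<epsilon> :: real
  assumes "\<P> \<subseteq> space (prob_algebra X)"
    and "\<theta> \<in> \<P> \<rightarrow> space \<Theta>"
    and "semimetric_on (space \<Theta>) \<rho>"
    and "\<And>t. t \<in> space \<Theta> \<Longrightarrow> (\<lambda>s. \<rho> s t) \<in> borel_measurable \<Theta>"
    and "mono_on {0..} \<Phi>" and "\<Phi> 0 = 0"
    and "0 \<le> \<epsilon>" and "\<epsilon> < 1" and "0 < \<alpha>"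
    and regular:
      "tv_modulus \<P> \<theta> \<rho> \<epsilon> \<in> {0, \<top>} \<or>
       (\<exists>R0\<in>\<P>. \<exists>R1\<in>\<P>. tv_dist R0 R1 \<le> \<epsilon> / (1 - \<epsilon>) \<and>
          ennreal (\<rho> (\<theta> R0) (\<theta> R1)) = tv_modulus \<P> \<theta> \<rho> \<epsilon>) \<or>
       continuous (at_left (enn2real (tv_modulus \<P> \<theta> \<rho> \<epsilon> / 2))) \<Phi>"
  shows "minimax_risk n \<alpha> X Z \<Theta> \<P> \<theta> \<rho> \<Phi> \<epsilon>
    \<ge> max (minimax_risk n \<alpha> X Z \<Theta> \<P> \<theta> \<rho> \<Phi> 0)
          (loss_ext \<Phi> (tv_modulus \<P> \<theta> \<rho> \<epsilon> / 2) / 2)"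
proof (rule max.boundedI)
  let ?M = "minimax_risk n \<alpha> X Z \<Theta> \<P> \<theta> \<rho> \<Phi> \<epsilon>"
  show "minimax_risk n \<alpha> X Z \<Theta> \<P> \<theta> \<rho> \<Phi> 0 \<le> ?M"
    using assms by (intro minimax_risk_mono_contamination) auto
  define D where "D = {\<rho> (\<theta> R0) (\<theta> R1) | R0 R1.
    R0 \<in> \<P> \<and> R1 \<in> \<P> \<and> tv_dist R0 R1 \<le> \<epsilon> / (1 - \<epsilon>)}"
  \<comment> \<open>The factor one half is moved to the risk side, so that \<open>2 * ?M\<close> can
    serve as the uniform bound \<open>c\<close> in \<open>loss_ext_le\<close>.\<close>
  have "loss_ext \<Phi> (tv_modulus \<P> \<theta> \<rho> \<epsilon> / 2) \<le> 2 * ?M"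
  proof (rule loss_ext_le[where D = D])
    fix r assume "r \<in> D"
    then obtain R0 R1 where R: "R0 \<in> \<P>" "R1 \<in> \<P>" "tv_dist R0 R1 \<le> \<epsilon> / (1 - \<epsilon>)"
      and r: "r = \<rho> (\<theta> R0) (\<theta> R1)"
      by (auto simp: D_def)
    show "0 \<le> r"
      using R assms(2,3) unfolding r semimetric_on_def by (meson PiE funcset_mem)
    have "ennreal (\<Phi> (r / 2)) / 2 \<le> ?M"
      unfolding r using assms R by (intro minimax_risk_ge_two_point) auto
    then have "2 * (ennreal (\<Phi> (r / 2)) / 2) \<le> 2 * ?M"
      by (rule mult_left_mono) simp
    then show "ennreal (\<Phi> (r / 2)) \<le> 2 * ?M"
      by (simp add: ennreal_times_divide ennreal_mult_divide_eq mult.commute[of 2 "ennreal _"])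
  next
    show "tv_modulus \<P> \<theta> \<rho> \<epsilon> = (SUP r\<in>D. ennreal r)"
      unfolding tv_modulus_def D_def by (rule arg_cong[where f = Sup]) auto
    show "tv_modulus \<P> \<theta> \<rho> \<epsilon> \<in> {0, \<top>} \<or> tv_modulus \<P> \<theta> \<rho> \<epsilon> \<in> ennreal ` D \<or>
        continuous (at_left (enn2real (tv_modulus \<P> \<theta> \<rho> \<epsilon> / 2))) \<Phi>"
      using regular by (force simp: D_def)
  qed fact+
  then show "loss_ext \<Phi> (tv_modulus \<P> \<theta> \<rho> \<epsilon> / 2) / 2 \<le> ?M"
    by (simp add: divide_le_posI_ennreal)
qed

end
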